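(* Let $\Sigma$ and $\Gamma$ be alphabets and let $w \in \Sigma^+$ be a primitive word. If $|w|_a \ne 1$ for all $a \in \Sigma$, then $\max(\mathrm{Exp}_{\mathcal I(\Sigma,\Gamma)}(w)) < |w|$.
   Context: Alphabets are finite and have at least two letters. $\Sigma^*$ (resp. $\Sigma^+$) is the set of all (resp. all nonempty) words over $\Sigma$; $|w|$ is the length of $w$ and $|w|_a$ is the number of occurrences of the letter $a$ in $w$; $\mathbb Z_+$ is the set of positive integers. A nonempty word is primitive if it is not a power of a shorter word. A morphism $h:\Sigma^*\to\Gamma^*$ is a map with $h(xy)=h(x)h(y)$ for all words $x,y$. $\mathcal I(\Sigma,\Gamma)$ is the family of all injective morphisms $\Sigma^*\to\Gamma^*$. For a family $H$ of morphisms $\Sigma^*\to\Gamma^*$ and $w\in\Sigma^+$, define $\mathrm{Exp}_H(w)=\{n\in\mathbb Z_+ \mid \exists h\in H,\ r\in\Gamma^+ : h(w)=r^n \text{ and } r \text{ is primitive}\}$. *)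

theory Defs
  imports "HOL-Library.Cardinality"
begin

text \<open>
  An alphabet is a finite type (with at least two elements, where that matters), and the words
  over it are the lists over that type.
\<close>

definition word_pow :: "'a list \<Rightarrow> nat \<Rightarrow> 'a list" where
  "word_pow r n = concat (replicate n r)"

definition primitive :: "'a list \<Rightarrow> bool" where
  "primitive w \<longleftrightarrow> w \<noteq> [] \<and> \<not> (\<exists>r n. length r < length w \<and> w = word_pow r n)"

definition morphism :: "('a list \<Rightarrow> 'b list) \<Rightarrow> bool" where
  "morphism h \<longleftrightarrow> (\<forall>x y. h (x @ y) = h x @ h y)"

text \<open>Injectivity is that of the map on words, not merely of its restriction to letters.\<close>

definition inj_morphisms :: "('a list \<Rightarrow> 'b list) set" where
  "inj_morphisms = {h. morphism h \<and> inj h}"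

definition Exp :: "('a list \<Rightarrow> 'b list) set \<Rightarrow> 'a list \<Rightarrow> nat set" where
  "Exp H w = {n. n > 0 \<and> (\<exists>h\<in>H. \<exists>r. r \<noteq> [] \<and> h w = word_pow r n \<and> primitive r)}"

end

theory Submission
  imports Defs
begin

text \<open>
  If \<open>h w = r\<^sup>n\<close> with \<open>n \<ge> length w\<close>, then some letter \<open>a\<close> of \<open>w\<close> satisfies
  \<open>length (h [a]) \<ge> length r\<close>.  As \<open>a\<close> occurs at least twice, \<open>w\<close> can be rotated to \<open>p @ q\<close> where
  both \<open>p\<close> and \<open>q\<close> begin with \<open>a\<close>, and \<open>h (p @ q)\<close> is a power of a conjugate \<open>r'\<close> of \<open>r\<close>.
  Both \<open>h p\<close> and \<open>h q\<close> begin with \<open>r'\<close>, and a primitive word occurs in its own powers only at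
  the obvious positions; so \<open>h p\<close> and \<open>h q\<close> are powers of \<open>r'\<close>.  They commute,
  hence so do \<open>p\<close> and \<open>q\<close> by injectivity, and \<open>w\<close> is not primitive.
\<close>

section \<open>Powers, conjugates and primitivity of words\<close>

lemma word_pow_0 [simp]: "word_pow r 0 = []"
  and word_pow_Suc [simp]: "word_pow r (Suc n) = r @ word_pow r n"
  by (simp_all add: word_pow_def)

lemma word_pow_add: "word_pow r (m + n) = word_pow r m @ word_pow r n"
  by (induction m) auto

lemma word_pow_mult: "word_pow (word_pow r m) n = word_pow r (m * n)"
  by (induction n) (auto simp: word_pow_add)

lemma length_word_pow: "length (word_pow r n) = n * length r"
  by (induction n) auto

lemma word_pow_shift: "word_pow (s @ t) n @ s = s @ word_pow (t @ s) n"
  by (induction n) auto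

lemma rotate_word_pow: "rotate k (word_pow r n) = word_pow (rotate k r) n"
proof (induction k)
  case (Suc k)
  have "rotate1 (word_pow u n) = word_pow (rotate1 u) n" for u :: "'a list"
  proof (cases u)
    case Nil
    then show ?thesis by (simp add: word_pow_def)
  next
    case (Cons c v)
    show ?thesis
    proof (cases n)
      case (Suc m)
      then show ?thesis
        using word_pow_shift[of "[c]" v m] Cons by simp
    qed simp
  qed
  with Suc show ?case by simp
qed simp

lemma primitive_rotate:
  assumes "primitive w"
  shows "primitive (rotate k w)"
  unfolding primitive_def
proof (intro conjI notI)
  assume "rotate k w = []"
  with assms show False by (simp add: primitive_def)
next
  assume "\<exists>r n. length r < length (rotate k w) \<and> rotate k w = word_pow r n"
  then obtain r n where r: "length r < length w" "rotate k w = word_pow r n" by auto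
  \<comment> \<open>\<open>j\<close> completes the rotation by \<open>k\<close> to a full turn,
    which carries a power representation of the conjugate back to \<open>w\<close>.\<close>
  define j where "j = length w - k mod length w"
  have "w \<noteq> []" using assms by (simp add: primitive_def)
  then have "rotate j (rotate (k mod length w) w) = w"
    by (simp add: rotate_rotate j_def)
  then have "w = word_pow (rotate j r) n"
    using r(2) rotate_word_pow[of j r n] rotate_conv_mod[of k w] by simp
  with r(1) assms show False unfolding primitive_def by (metis length_rotate)
qed

text \<open>Commuting words are powers of a common word \<open>z\<close>; since neither factor is
  empty, \<open>z\<close> is shorter than \<open>x @ y\<close>.\<close>

lemma not_primitive_if_commute:
  assumes "x @ y = y @ x" "x \<noteq> []" "y \<noteq> []"
  shows "\<not> primitive (x @ y)"
proof -
  obtain m n z where z: "word_pow z m = x" "word_pow z n = y"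
    using comm_append_are_replicate[OF assms(1)] unfolding word_pow_def by blast
  have "length z \<le> length x"
    using z(1) assms(2) by (cases m) auto
  then have "length z < length (x @ y)" using assms(3) by (cases y) auto
  moreover have "x @ y = word_pow z (m + n)" using z by (simp add: word_pow_add)
  ultimately show ?thesis unfolding primitive_def by blast
qed

lemma ex_primitive_root:
  assumes "w \<noteq> []"
  shows "\<exists>r n. primitive r \<and> n > 0 \<and> w = word_pow r n"
  using assms
proof (induction w rule: length_induct)
  case (1 w)
  show ?case
  proof (cases "primitive w")
    case True
    then have "primitive w \<and> 1 > (0::nat) \<and> w = word_pow w 1" by simp
    then show ?thesis by blast
  next
    case False
    then obtain s m where s: "length s < length w" "w = word_pow s m"
      using 1(2) unfolding primitive_def by blast
    then have "s \<noteq> []" "m > 0"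
      using 1(2) length_word_pow[of s m] by (auto intro!: Nat.gr0I)
    then obtain r n where "primitive r" "n > 0" "s = word_pow r n"
      using 1(1) s(1) by blast
    with s(2) \<open>m > 0\<close> show ?thesis
      by (metis word_pow_mult nat_0_less_mult_iff)
  qed
qed

text \<open>The cut falls inside some copy of \<open>r\<close>. A cut between two copies counts as
  the start of the later one, hence \<open>t \<noteq> []\<close>; such a copy exists because
  \<open>y\<close> is nonempty.\<close>

lemma word_pow_eq_append:
  assumes "x @ y = word_pow r n" "y \<noteq> []"
  obtains i s t m where "r = s @ t" "t \<noteq> []" "x = word_pow r i @ s" "y = t @ word_pow r m"
  using assms
proof (induction n arbitrary: x thesis)
  case (Suc n)
  show ?case
  proof (cases "length x < length r")
    case True
    from Suc.prems(2) have eq: "x @ y = r @ word_pow r n" by simp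
    with True have "x = take (length x) r" "y = drop (length x) r @ word_pow r n"
      by (auto simp: append_eq_append_conv_if split: if_splits)
    with True Suc.prems(1)[of x "drop (length x) r" 0 n] show ?thesis
      by (metis append_take_drop_id drop_eq_Nil2 leD append_Nil word_pow_0)
  next
    case False
    with Suc.prems(2) obtain x' where x': "x = r @ x'" "x' @ y = word_pow r n"
      by (auto simp: append_eq_append_conv2)
    obtain i s t m where "r = s @ t" "t \<noteq> []" "x' = word_pow r i @ s" "y = t @ word_pow r m"
      using Suc.IH[OF _ x'(2) Suc.prems(3)] by blast
    with x'(1) Suc.prems(1)[of s t "Suc i" m] show ?thesis by simp
  qed
qed simp

lemma primitive_synchronize:
  assumes "primitive r" "x @ r @ z = word_pow r n"
  shows "\<exists>i. x = word_pow r i"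
proof -
  have "r \<noteq> []" using assms(1) by (simp add: primitive_def)
  obtain i s t m where st: "r = s @ t" "t \<noteq> []" "x = word_pow r i @ s" "r @ z = t @ word_pow r m"
    by (rule word_pow_eq_append[of x "r @ z" r n]) (use assms \<open>r \<noteq> []\<close> in auto)
  have "s = []"
  proof (rule ccontr)
    assume "s \<noteq> []"
    \<comment> \<open>Here \<open>t\<close> is shorter than \<open>r\<close>, so a further copy of
      \<open>r\<close> must follow it.\<close>
    then have "m \<noteq> 0" using st(1) arg_cong[OF st(4), of length] by (auto intro!: Nat.gr0I)
    then obtain m' where "m = Suc m'" by (cases m) auto
    \<comment> \<open>Comparing prefixes of length \<open>length r\<close> makes \<open>s\<close>
      and \<open>t\<close> commute, against primitivity.\<close>
    then have "(s @ t) @ z = (t @ s) @ t @ word_pow r m'"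
      using st(1,4) by simp
    then have "s @ t = t @ s"
      by (rule append_eq_append_conv[THEN iffD1, THEN conjunct1, rotated]) simp
    with not_primitive_if_commute \<open>s \<noteq> []\<close> st(1,2) assms(1) show False by blast
  qed
  with st show ?thesis by auto
qed

section \<open>Images under morphisms and the bound on the exponent\<close>

lemma morphism_Nil: "morphism h \<Longrightarrow> h [] = []"
  unfolding morphism_def by (metis append_Nil append_self_conv)

lemma morphism_append: "morphism h \<Longrightarrow> h (x @ y) = h x @ h y"
  by (simp add: morphism_def)

text \<open>Each letter falls short of \<open>L\<close> by at least one; the summand
  \<open>length w\<close> collects these savings without subtraction.\<close>

lemma length_morphism_le:
  assumes "morphism h" "\<forall>a\<in>set w. length (h [a]) < L"
  shows "length (h w) + length w \<le> length w * L"
  using assms(2)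
proof (induction w)
  case Nil
  then show ?case by (simp add: morphism_Nil[OF assms(1)])
next
  case (Cons a w)
  have "h (a # w) = h [a] @ h w" using morphism_append[OF assms(1), of "[a]" w] by simp
  with Cons show ?case by simp
qed

lemma split_two_occurrences:
  assumes "a \<in> set w" "count_list w a \<noteq> 1"
  obtains x u v where "w = x @ a # u @ a # v"
proof -
  \<comment> \<open>Taking the first occurrence keeps \<open>x\<close> out of the count, so a second
    one must lie in \<open>y\<close>.\<close>
  obtain x y where w: "w = x @ a # y" and "a \<notin> set x"
    using split_list_first[OF assms(1)] by blast
  then have "count_list y a \<noteq> 0" using assms(2) by simp
  then have "a \<in> set y" by (simp add: count_list_0_iff)
  then obtain u v where "y = u @ a # v" by (auto dest: split_list)
  with w that show thesis by blast
qed

lemma exponent_less_length: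
  assumes h: "morphism h" "inj h"
    and w: "primitive w" "\<forall>a. count_list w a \<noteq> 1"
    and r: "primitive r" "h w = word_pow r n"
  shows "n < length w"
proof (rule ccontr)
  assume "\<not> n < length w"
  have "\<exists>a\<in>set w. length r \<le> length (h [a])"
  proof (rule ccontr)
    assume "\<not> ?thesis"
    then have "length (h w) + length w \<le> length w * length r"
      using length_morphism_le[OF h(1), of w "length r"] by (auto simp: not_le)
    also have "\<dots> \<le> length (h w)"
      using \<open>\<not> n < length w\<close> by (simp add: r(2) length_word_pow)
    finally show False using w(1) by (simp add: primitive_def)
  qed
  then obtain a where a: "a \<in> set w" "length r \<le> length (h [a])" by blast
  obtain x u v where w_eq: "w = x @ a # u @ a # v"
    using split_two_occurrences a(1) w(2) by metis
  define p q where "p = a # u" and "q = a # v @ x"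
  \<comment> \<open>Rotating \<open>w\<close> past \<open>x\<close> rotates \<open>h w\<close> past
    \<open>h x\<close>, and rotation acts on each period alike.\<close>
  define r' where "r' = rotate (length (h x)) r"
  have "p @ q = rotate (length x) w"
    by (simp add: w_eq p_def q_def rotate_append)
  then have prim: "primitive (p @ q)"
    using primitive_rotate[OF w(1)] by simp
  have r': "primitive r'" "length r' = length r"
    using primitive_rotate[OF r(1)] by (simp_all add: r'_def)
  have "h (p @ q) = rotate (length (h x)) (h w)"
    using morphism_append[OF h(1), of x "a # u @ a # v"]
      morphism_append[OF h(1), of "a # u @ a # v" x]
    by (simp add: w_eq p_def q_def rotate_append)
  then have eq: "h p @ h q = word_pow r' n"
    using r(2) by (simp add: morphism_append[OF h(1)] rotate_word_pow r'_def)
  have hp: "h p = h [a] @ h u" and hq: "h q = h [a] @ h (v @ x)"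
    using morphism_append[OF h(1), of "[a]" u] morphism_append[OF h(1), of "[a]" "v @ x"]
    by (simp_all add: p_def q_def)
  have "r' \<noteq> []" using r'(1) by (simp add: primitive_def)
  have "h [a] \<noteq> []" using a(2) r'(2) \<open>r' \<noteq> []\<close> by auto
  then obtain k where "n = Suc k" using eq hp by (cases n) auto
  then have "h [a] @ h u @ h q = r' @ word_pow r' k" using eq hp by simp
  \<comment> \<open>As \<open>h [a]\<close> is at least as long as \<open>r'\<close>, the whole
    prefix \<open>r'\<close> lies within it.\<close>
  from arg_cong[OF this, of "take (length r')"] have "take (length r') (h [a]) = r'"
    using a(2) r'(2) by simp
  then obtain b where b: "h [a] = r' @ b"
    by (metis append_take_drop_id)
  \<comment> \<open>\<open>h q\<close> also begins with \<open>h [a]\<close>, so a copy of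
    \<open>r'\<close> starts right after \<open>h p\<close>.\<close>
  obtain i where i: "h p = word_pow r' i"
    using primitive_synchronize[OF r'(1), of "h p" "b @ h (v @ x)" n] eq hq b by auto
  have "length (word_pow r' i) \<le> length (word_pow r' n)"
    unfolding i[symmetric] eq[symmetric] by simp
  then have "i \<le> n" using \<open>r' \<noteq> []\<close> by (simp add: length_word_pow)
  then have "h p @ h q = h p @ word_pow r' (n - i)"
    using eq i word_pow_add[of r' i "n - i"] by simp
  then have "h q = word_pow r' (n - i)" by simp
  \<comment> \<open>Powers of the same word commute; injectivity on words transfers this to
    \<open>p\<close> and \<open>q\<close>.\<close>
  then have "h (p @ q) = h (q @ p)"
    using i by (simp add: morphism_append[OF h(1)] flip: word_pow_add) (simp add: add.commute)
  then have "p @ q = q @ p" by (rule injD[OF h(2)])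
  moreover have "p \<noteq> []" "q \<noteq> []" by (simp_all add: p_def q_def)
  ultimately show False using not_primitive_if_commute prim by blast
qed

section \<open>Existence of injective morphisms\<close>

lemma inj_concat_map_uniform:
  assumes "inj f" "\<And>a. length (f a) = k" "k > 0"
  shows "inj (\<lambda>w. concat (map f w))"
proof (rule injI)
  fix x y
  assume "concat (map f x) = concat (map f y)"
  then show "x = y"
  proof (induction x arbitrary: y)
    case Nil
    then show ?case using assms(2,3) by (cases y) (auto, metis less_numeral_extra(3) list.size(3))
  next
    case (Cons a x)
    then obtain b z where y: "y = b # z"
      using assms(2)[of a] assms(3) by (cases y) auto
    with Cons.prems assms(2) have "f a = f b" "concat (map f x) = concat (map f z)" by auto
    with y Cons.IH injD[OF assms(1)] show ?case by blast
  qed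
qed

text \<open>Letters are encoded by distinct blocks of one length. Taking \<open>CARD('a)\<close> as
  block length gives enough blocks, since \<open>k < 2 ^ k\<close>.\<close>

lemma inj_morphisms_nonempty:
  assumes "CARD('b::finite) \<ge> 2"
  shows "(inj_morphisms :: ('a::finite list \<Rightarrow> 'b list) set) \<noteq> {}"
proof -
  define k where "k = CARD('a)"
  define B where "B = {xs :: 'b list. length xs = k}"
  have B: "finite B" "card B = CARD('b) ^ k"
    using finite_lists_length_eq[of "UNIV :: 'b set" k] card_lists_length_eq[of "UNIV :: 'b set" k]
    by (simp_all add: B_def)
  have "k < 2 ^ k" by (rule less_exp)
  also have "\<dots> \<le> card B" using assms by (simp add: B power_mono)
  finally have "card (UNIV :: 'a set) \<le> card B" by (simp add: k_def)
  then obtain f :: "'a \<Rightarrow> 'b list" where f: "f ` UNIV \<subseteq> B" "inj f"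
    using card_le_inj[of "UNIV :: 'a set" B] B(1) by auto
  then have "inj (\<lambda>w. concat (map f w))"
    by (intro inj_concat_map_uniform[of f k]) (auto simp: B_def k_def)
  moreover have "morphism (\<lambda>w. concat (map f w))" by (simp add: morphism_def)
  ultimately show ?thesis unfolding inj_morphisms_def by blast
qed

text \<open>\<open>Max\<close> is meaningful only on finite nonempty sets, so both properties
  accompany the bound. Nonemptiness comes from the primitive root of the image of \<open>w\<close>
  under any injective morphism.\<close>

theorem theorem4p2:
  fixes w :: "'a::finite list"
  assumes "CARD('a) \<ge> 2" and "CARD('b::finite) \<ge> 2"
    and "w \<noteq> []" and "primitive w"
    and "\<forall>a. count_list w a \<noteq> 1"
  shows "finite (Exp (inj_morphisms :: ('a list \<Rightarrow> 'b list) set) w)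
       \<and> Exp (inj_morphisms :: ('a list \<Rightarrow> 'b list) set) w \<noteq> {}
       \<and> Max (Exp (inj_morphisms :: ('a list \<Rightarrow> 'b list) set) w) < length w"
proof -
  let ?E = "Exp (inj_morphisms :: ('a list \<Rightarrow> 'b list) set) w"
  have sub: "?E \<subseteq> {..<length w}"
    using exponent_less_length[OF _ _ assms(4,5)]
    by (auto simp: Exp_def inj_morphisms_def)
  then have fin: "finite ?E" by (rule finite_subset) simp
  obtain h :: "'a list \<Rightarrow> 'b list" where h: "h \<in> inj_morphisms"
    using inj_morphisms_nonempty[OF assms(2)] by blast
  then have "h w \<noteq> []"
    using morphism_Nil[of h] assms(3) unfolding inj_morphisms_def by (metis injD mem_Collect_eq)
  then obtain r n where "primitive r" "n > 0" "h w = word_pow r n"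
    using ex_primitive_root by blast
  with h have "n \<in> ?E" by (auto simp: Exp_def primitive_def)
  then have ne: "?E \<noteq> {}" by blast
  with fin sub Max_in show ?thesis by blast
qed

end
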